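(* For a class of graphs $\mathcal{G}$, the following statements are equivalent. (a) $\mathcal{G}$ has bounded expansion. (b) There exists a function $f:\mathbb{Z}_{\ge 0}\to\mathbb{Z}_{\ge 0}$ such that for every $G\in\mathcal{G}$ and every non-negative integer $k$, $\widetilde{\nabla}^\circ_k(G)\le f(k)$. (c) There exists a function $f:\mathbb{Z}_{\ge 0}\to\mathbb{Z}_{\ge 0}$ such that for every $G\in\mathcal{G}$ and every non-negative integer $k$, $\widetilde{\nabla}^e_k(G)\le f(k)$.
   Context: Graphs are finite, simple, undirected, and have at least one vertex. The average degree of a graph $F$ is $2|E(F)|/|V(F)|$. For a non-negative integer $k$, a $(\le k)$-subdivision of a graph $F$ is a graph obtained from $F$ by subdividing each of its edges by at most $k$ vertices (not necessarily the same number on each edge). The $k$-subdivision of $F$ is the graph obtained from $F$ by subdividing each edge exactly $k$ times. For a graph $G$ and a non-negative integer $k$: - $\widetilde{\nabla}_k(G)$ is the maximum of the average degrees of graphs $F$ such that some $(\le k)$-subdivision of $F$ appears as a (not necessarily induced) subgraph of $G$; - $\widetilde{\nabla}^\circ_k(G)$ is the maximum of the average degrees of graphs $F$ such that some $(\le k)$-subdivision of $F$ appears as an induced subgraph of $G$; - $\widetilde{\nabla}^e_k(G)$ is the maximum of the average degrees of graphs $F$ such that the $k$-subdivision of $F$ appears as an induced subgraph of $G$. A class of graphs $\mathcal{G}$ has bounded expansion if there exists a function $f:\mathbb{Z}_{\ge 0}\to\mathbb{Z}_{\ge 0}$ such that $\widetilde{\nabla}_k(G)\le f(k)$ for every $G\in\mathcal{G}$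 and every non-negative integer $k$. *)

theory Defs
  imports Complex_Main
begin

text \<open>A graph is a pair of a vertex set and a set of two-element vertex sets.\<close>

type_synonym 'a ugraph = "'a set \<times> 'a set set"

abbreviation verts :: "'a ugraph \<Rightarrow> 'a set" where "verts G \<equiv> fst G"
abbreviation edges :: "'a ugraph \<Rightarrow> 'a set set" where "edges G \<equiv> snd G"

definition simple_graph :: "'a ugraph \<Rightarrow> bool" where
  "simple_graph G \<longleftrightarrow> finite (verts G) \<and> verts G \<noteq> {} \<and>
     (\<forall>e\<in>edges G. e \<subseteq> verts G \<and> card e = 2)"

definition avg_degree :: "'a ugraph \<Rightarrow> real" where
  "avg_degree G = 2 * real (card (edges G)) / real (card (verts G))"

definition subgraph :: "'a ugraph \<Rightarrow> 'a ugraph \<Rightarrow> bool" where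
  "subgraph H G \<longleftrightarrow> verts H \<subseteq> verts G \<and> edges H \<subseteq> edges G"

definition induced_subgraph :: "'a ugraph \<Rightarrow> 'a ugraph \<Rightarrow> bool" where
  "induced_subgraph H G \<longleftrightarrow> verts H \<subseteq> verts G \<and> edges H = {e \<in> edges G. e \<subseteq> verts H}"

definition graph_iso :: "'a ugraph \<Rightarrow> 'b ugraph \<Rightarrow> bool" where
  "graph_iso G H \<longleftrightarrow> (\<exists>f. bij_betw f (verts G) (verts H) \<and> edges H = (\<lambda>e. f ` e) ` edges G)"

definition appears_in :: "'b ugraph \<Rightarrow> 'a ugraph \<Rightarrow> bool" where
  "appears_in H G \<longleftrightarrow> (\<exists>H'. subgraph H' G \<and> graph_iso H H')"

definition appears_induced_in :: "'b ugraph \<Rightarrow> 'a ugraph \<Rightarrow> bool" where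
  "appears_induced_in H G \<longleftrightarrow> (\<exists>H'. induced_subgraph H' G \<and> graph_iso H H')"

text \<open>
  The graph \<open>subdivide F s\<close> arises from \<open>F\<close> by subdividing each edge \<open>e\<close> exactly \<open>s e\<close> times:
  \<open>e\<close> is replaced by a path through the new vertices \<open>Sub e 0, \<dots>, Sub e (s e - 1)\<close>. The
  linear order on the vertices of \<open>F\<close> only serves to choose a direction along each edge, and
  reversing a direction yields an isomorphic graph.
\<close>

datatype 'v subdiv_vertex = Branch 'v | Sub "'v set" nat

definition subdiv_path :: "('v::linorder set \<Rightarrow> nat) \<Rightarrow> 'v set \<Rightarrow> 'v subdiv_vertex list" where
  "subdiv_path s e = Branch (Min e) # map (Sub e) [0..<s e] @ [Branch (Max e)]"

definition path_edges :: "'a list \<Rightarrow> 'a set set" where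
  "path_edges p = {{p ! i, p ! Suc i} | i. Suc i < length p}"

definition subdivide :: "'v::linorder ugraph \<Rightarrow> ('v set \<Rightarrow> nat) \<Rightarrow> 'v subdiv_vertex ugraph" where
  "subdivide F s =
     (Branch ` verts F \<union> {Sub e i | e i. e \<in> edges F \<and> i < s e},
      \<Union>e\<in>edges F. path_edges (subdiv_path s e))"

definition le_subdivisions :: "nat \<Rightarrow> 'v::linorder ugraph \<Rightarrow> 'v subdiv_vertex ugraph set" where
  "le_subdivisions k F = {subdivide F s | s. \<forall>e\<in>edges F. s e \<le> k}"

definition k_subdivision :: "nat \<Rightarrow> 'v::linorder ugraph \<Rightarrow> 'v subdiv_vertex ugraph" where
  "k_subdivision k F = subdivide F (\<lambda>_. k)"

text \<open>
  Every finite graph is isomorphic to one on natural numbers, so it suffices to let \<open>F\<close>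
  range over graphs with vertices of type \<^typ>\<open>nat\<close>.
\<close>

definition top_degrees :: "nat \<Rightarrow> 'a ugraph \<Rightarrow> real set" where
  "top_degrees k G =
     {avg_degree F | F :: nat ugraph. simple_graph F \<and> (\<exists>H\<in>le_subdivisions k F. appears_in H G)}"

definition ind_top_degrees :: "nat \<Rightarrow> 'a ugraph \<Rightarrow> real set" where
  "ind_top_degrees k G =
     {avg_degree F | F :: nat ugraph. simple_graph F \<and>
        (\<exists>H\<in>le_subdivisions k F. appears_induced_in H G)}"

definition exact_top_degrees :: "nat \<Rightarrow> 'a ugraph \<Rightarrow> real set" where
  "exact_top_degrees k G =
     {avg_degree F | F :: nat ugraph. simple_graph F \<and> appears_induced_in (k_subdivision k F) G}"

definition nabla :: "nat \<Rightarrow> 'a ugraph \<Rightarrow> real" where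
  "nabla k G = Max (top_degrees k G)"

definition nabla_ind :: "nat \<Rightarrow> 'a ugraph \<Rightarrow> real" where
  "nabla_ind k G = Max (ind_top_degrees k G)"

definition nabla_exact :: "nat \<Rightarrow> 'a ugraph \<Rightarrow> real" where
  "nabla_exact k G = Max (exact_top_degrees k G)"

definition bounded_expansion :: "'a ugraph set \<Rightarrow> bool" where
  "bounded_expansion \<G> \<longleftrightarrow> (\<exists>f :: nat \<Rightarrow> nat. \<forall>G\<in>\<G>. \<forall>k. nabla k G \<le> real (f k))"

text \<open>The three maxima above are taken over finite nonempty sets.\<close>

lemma exact_subset_ind: "exact_top_degrees k G \<subseteq> ind_top_degrees k G"
  unfolding exact_top_degrees_def ind_top_degrees_def k_subdivision_def le_subdivisions_def
  by blast

lemma ind_subset_top: "ind_top_degrees k G \<subseteq> top_degrees k G"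
proof -
  have "appears_induced_in H G \<Longrightarrow> appears_in H G" for H :: "nat subdiv_vertex ugraph"
    unfolding appears_induced_in_def appears_in_def induced_subgraph_def subgraph_def by blast
  then show ?thesis
    unfolding ind_top_degrees_def top_degrees_def by blast
qed

lemma finite_top_degrees:
  assumes "simple_graph G"
  shows "finite (top_degrees k G)"
proof -
  let ?n = "card (verts G)"
  let ?D = "(\<lambda>(m, n). 2 * real m / real n) ` ({..2 ^ ?n} \<times> {..?n})"
  have "top_degrees k G \<subseteq> ?D"
  proof
    fix d assume "d \<in> top_degrees k G"
    then obtain F :: "nat ugraph" and s where
      d: "d = avg_degree F" and F: "simple_graph F" and app: "appears_in (subdivide F s) G"
      unfolding top_degrees_def le_subdivisions_def by blast
    from app obtain H f where
      H: "verts H \<subseteq> verts G" and f: "bij_betw f (verts (subdivide F s)) (verts H)"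
      unfolding appears_in_def subgraph_def graph_iso_def by auto
    have inj: "inj_on f (verts (subdivide F s))"
      using f by (rule bij_betw_imp_inj_on)
    have im: "f ` verts (subdivide F s) \<subseteq> verts G"
      using bij_betw_imp_surj_on[OF f] H by simp
    have sub: "Branch ` verts F \<subseteq> verts (subdivide F s)"
      by (simp add: subdivide_def)
    have "inj_on (f \<circ> Branch) (verts F)"
      using inj_on_subset[OF inj sub] by (intro comp_inj_on) (auto simp: inj_on_def)
    moreover have "(f \<circ> Branch) ` verts F \<subseteq> verts G"
      using image_mono[OF sub, of f] im unfolding image_comp[symmetric] by (rule order_trans)
    moreover have "finite (verts G)"
      using assms by (simp add: simple_graph_def)
    ultimately have v: "card (verts F) \<le> ?n"
      by (rule card_inj_on_le)
    have "finite (verts F)" "edges F \<subseteq> Pow (verts F)"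
      using F by (auto simp: simple_graph_def)
    then have "card (edges F) \<le> 2 ^ card (verts F)"
      by (metis card_Pow card_mono finite_Pow_iff)
    also have "\<dots> \<le> 2 ^ ?n"
      using v by (simp add: power_increasing)
    finally have "(card (edges F), card (verts F)) \<in> {..2 ^ ?n} \<times> {..?n}"
      using v by simp
    then show "d \<in> ?D"
      unfolding d avg_degree_def by (rule rev_image_eqI) simp
  qed
  then show ?thesis
    by (rule finite_subset) simp
qed

lemma exact_top_degrees_nonempty:
  assumes "simple_graph G"
  shows "exact_top_degrees k G \<noteq> {}"
proof -
  from assms obtain x where x: "x \<in> verts G"
    by (auto simp: simple_graph_def)
  let ?F = "({0}, {}) :: nat ugraph"
  have "\<not> e \<subseteq> {x}" if "e \<in> edges G" for e
  proof
    assume "e \<subseteq> {x}"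
    then have "card e \<le> card {x}"
      by (intro card_mono) simp_all
    with assms that show False
      unfolding simple_graph_def by fastforce
  qed
  then have "induced_subgraph ({x}, {}) G"
    using x unfolding induced_subgraph_def by simp
  moreover have "graph_iso (k_subdivision k ?F) ({x}, {})"
    unfolding graph_iso_def k_subdivision_def subdivide_def
    by (intro exI[of _ "\<lambda>_. x"]) (simp add: bij_betw_def)
  ultimately have "appears_induced_in (k_subdivision k ?F) G"
    unfolding appears_induced_in_def by blast
  moreover have "simple_graph ?F"
    by (simp add: simple_graph_def)
  ultimately show ?thesis
    unfolding exact_top_degrees_def by blast
qed

end

theory Submission
  imports Defs
begin

text \<open>
  Only the step from exact induced subdivisions to bounded expansion is not immediate. The bound for
  \<open>k = 0\<close> bounds the average degree of every induced subgraph of \<open>G\<close>, so \<open>G\<close> has an orientation of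
  outdegree at most \<open>d = f 0\<close>. Given a subdivision of \<open>F\<close> in \<open>G\<close>, replace the path of each edge \<open>e\<close>
  by an induced path \<open>P e\<close> of \<open>G\<close> on a subset of its vertices. In a random vertex set \<open>R\<close>, the edge
  \<open>e\<close> survives if \<open>P e\<close> lies in \<open>R\<close> but no out-neighbour of \<open>P e\<close> outside \<open>P e\<close> does; this
  has probability at least \<open>2\<close> to the power \<open>- (k + 2) * (d + 1)\<close>. An edge of \<open>G\<close> between vertices
  of surviving paths is directed from some \<open>x\<close> on a surviving \<open>P e\<close> to some \<open>y\<close> in \<open>R\<close>, so \<open>y\<close> is
  on \<open>P e\<close> as well. Hence the surviving paths with exactly \<open>j\<close> inner vertices form an induced
  \<open>j\<close>-subdivision, whose density \<open>f j\<close> controls; sum over \<open>j \<le> k\<close>.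
\<close>

section \<open>Paths, edges and subdivision paths\<close>

lemma path_edges_map: "path_edges (map f p) = (\<lambda>e. f ` e) ` path_edges p"
proof -
  have "path_edges (map f p) = {{map f p ! i, map f p ! Suc i} | i. Suc i < length p}"
    by (simp add: path_edges_def)
  also have "\<dots> = {f ` {p ! i, p ! Suc i} | i. Suc i < length p}"
  proof -
    have "{map f p ! i, map f p ! Suc i} = f ` {p ! i, p ! Suc i}" if "Suc i < length p" for i
      using that by simp
    then show ?thesis by blast
  qed
  also have "\<dots> = (\<lambda>e. f ` e) ` path_edges p"
    unfolding path_edges_def by blast
  finally show ?thesis .
qed

lemma path_edges_subset_set: "e \<in> path_edges p \<Longrightarrow> e \<subseteq> set p"
  by (auto simp: path_edges_def)

lemma simple_graph_edge:
  assumes "simple_graph G" "e \<in> edges G"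
  obtains u v where "e = {u, v}" "u \<noteq> v" "u \<in> verts G" "v \<in> verts G"
proof -
  have "card e = 2" "e \<subseteq> verts G"
    using assms by (auto simp: simple_graph_def)
  then show thesis
    using that by (metis card_2_iff insert_subset)
qed

lemma finite_edges: "simple_graph G \<Longrightarrow> finite (edges G)"
  by (rule finite_subset[of _ "Pow (verts G)"]) (auto simp: simple_graph_def)

lemma Min_Max_card_2:
  fixes e :: "'v::linorder set"
  assumes "card e = 2"
  shows "e = {Min e, Max e}" "Min e \<noteq> Max e"
proof -
  obtain u v where "e = {u, v}" "u \<noteq> v"
    using assms by (auto simp: card_2_iff)
  then show "e = {Min e, Max e}" "Min e \<noteq> Max e"
    by (cases "u < v"; auto simp: min_def max_def)+
qed

lemma set_subdiv_path:
  "set (subdiv_path s e) = {Branch (Min e), Branch (Max e)} \<union> Sub e ` {..<s e}"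
  by (auto simp: subdiv_path_def)

lemma length_subdiv_path [simp]: "length (subdiv_path s e) = s e + 2"
  by (simp add: subdiv_path_def)

lemma set_subdiv_path_subset:
  assumes "simple_graph F" "e \<in> edges F"
  shows "set (subdiv_path s e) \<subseteq> verts (subdivide F s)"
proof -
  have "card e = 2" "e \<subseteq> verts F"
    using assms by (auto simp: simple_graph_def)
  with Min_Max_card_2(1)[of e] have "Min e \<in> verts F" "Max e \<in> verts F"
    by auto
  then show ?thesis
    using assms(2) by (auto simp: set_subdiv_path subdivide_def)
qed

section \<open>Recognising an induced \<open>j\<close>-subdivision from its branch vertices and
  paths\<close>

text \<open>Interface that hides the datatype of subdivision vertices: it suffices to give images
  \<open>\<phi>\<close> of the branch vertices and a path \<open>P e\<close> for each edge.
  Distinctness of each path together with \<open>branch\<close> and \<open>disj\<close> makes the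
  induced vertex map injective, and \<open>induced\<close> rules out edges of \<open>G\<close>
  beyond the path edges.\<close>

lemma exact_top_degreesI:
  fixes F :: "nat ugraph" and P :: "nat set \<Rightarrow> 'a list"
  assumes F: "simple_graph F" and inj: "inj_on \<phi> (verts F)" and \<phi>: "\<phi> ` verts F \<subseteq> verts G"
    and len: "\<And>e. e \<in> edges F \<Longrightarrow> length (P e) = j + 2"
    and dist: "\<And>e. e \<in> edges F \<Longrightarrow> distinct (P e)"
    and hd: "\<And>e. e \<in> edges F \<Longrightarrow> hd (P e) = \<phi> (Min e)"
    and last: "\<And>e. e \<in> edges F \<Longrightarrow> last (P e) = \<phi> (Max e)"
    and set: "\<And>e. e \<in> edges F \<Longrightarrow> set (P e) \<subseteq> verts G"
    and path: "\<And>e. e \<in> edges F \<Longrightarrow> path_edges (P e) \<subseteq> edges G"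
    and branch: "\<And>e v. e \<in> edges F \<Longrightarrow> v \<in> verts F \<Longrightarrow> \<phi> v \<in> set (P e) \<Longrightarrow> v \<in> e"
    and disj: "\<And>e e' x. e \<in> edges F \<Longrightarrow> e' \<in> edges F \<Longrightarrow> e \<noteq> e' \<Longrightarrow> x \<in> set (P e) \<Longrightarrow>
      x \<in> set (P e') \<Longrightarrow> x \<in> \<phi> ` verts F"
    and induced: "\<And>h. h \<in> edges G \<Longrightarrow> h \<subseteq> \<phi> ` verts F \<union> (\<Union>e\<in>edges F. set (P e)) \<Longrightarrow>
      \<exists>e\<in>edges F. h \<in> path_edges (P e)"
  shows "avg_degree F \<in> exact_top_degrees j G"
proof -
  let ?S = "subdivide F (\<lambda>_. j)"
  \<comment> \<open>Position \<open>0\<close> of \<open>P e\<close> is the branch vertex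
    \<open>\<phi> (Min e)\<close>, so the \<open>i\<close>-th subdivision vertex sits at position
    \<open>Suc i\<close>.\<close>
  define f where "f x = (case x of Branch v \<Rightarrow> \<phi> v | Sub e i \<Rightarrow> P e ! Suc i)" for x
  have f_simps [simp]: "f (Branch v) = \<phi> v" "f (Sub e i) = P e ! Suc i" for v e i
    by (simp_all add: f_def)
  have map_f: "map f (subdiv_path (\<lambda>_. j) e) = P e" if e: "e \<in> edges F" for e
  proof (rule nth_equalityI)
    show "length (map f (subdiv_path (\<lambda>_. j) e)) = length (P e)"
      using len[OF e] by simp
    fix i assume "i < length (map f (subdiv_path (\<lambda>_. j) e))"
    then consider "i = 0" | i' where "i = Suc i'" "i' < j" | "i = Suc j"
      by (cases i) (auto simp: less_Suc_eq)
    then show "map f (subdiv_path (\<lambda>_. j) e) ! i = P e ! i"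
    proof cases
      case 1
      have "P e \<noteq> []" using len[OF e] by auto
      with 1 show ?thesis using hd[OF e] by (simp add: subdiv_path_def hd_conv_nth)
    next
      case 2
      then show ?thesis by (simp add: subdiv_path_def nth_append)
    next
      case 3
      have "P e \<noteq> []" using len[OF e] by auto
      with 3 show ?thesis using last[OF e] len[OF e]
        by (simp add: subdiv_path_def nth_append last_conv_nth)
    qed
  qed
  \<comment> \<open>If an inner vertex were some \<open>\<phi> v\<close>, then \<open>branch\<close>
    would make \<open>v\<close> an end of \<open>e\<close>, so the vertex would also occur at
    position \<open>0\<close> or \<open>Suc j\<close> of the distinct list
    \<open>P e\<close>.\<close>
  have sub_not_branch: "P e ! Suc i \<notin> \<phi> ` verts F" if e: "e \<in> edges F" and i: "i < j" for e i
  proof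
    assume "P e ! Suc i \<in> \<phi> ` verts F"
    then obtain v where v: "v \<in> verts F" "P e ! Suc i = \<phi> v" by auto
    have "P e ! Suc i \<in> set (P e)" using len[OF e] i by simp
    then have "v \<in> e" using branch[OF e v(1)] v(2) by simp
    moreover have "card e = 2" using F e by (simp add: simple_graph_def)
    ultimately have "v = Min e \<or> v = Max e" using Min_Max_card_2(1)[of e] by blast
    moreover have ne: "P e \<noteq> []" using len[OF e] by auto
    ultimately have "\<phi> v = P e ! 0 \<or> \<phi> v = P e ! Suc j"
      using hd[OF e] last[OF e] len[OF e] by (auto simp: hd_conv_nth last_conv_nth)
    with v(2) have "P e ! Suc i = P e ! 0 \<or> P e ! Suc i = P e ! Suc j" by simp
    then show False
      using nth_eq_iff_index_eq[OF dist[OF e]] len[OF e] i by auto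
  qed
  have inj_f: "inj_on f (verts ?S)"
  proof (rule inj_onI)
    fix x y assume x: "x \<in> verts ?S" and y: "y \<in> verts ?S" and eq: "f x = f y"
    show "x = y"
    proof (cases x)
      case xB: (Branch u)
      with x have u: "u \<in> verts F" by (auto simp: subdivide_def)
      show ?thesis
      proof (cases y)
        case (Branch v)
        then have "v \<in> verts F" using y by (auto simp: subdivide_def)
        then show ?thesis using inj u eq xB Branch by (auto dest: inj_onD)
      next
        case (Sub e i)
        then have "e \<in> edges F" "i < j" using y by (auto simp: subdivide_def)
        then show ?thesis using sub_not_branch[of e i] eq xB Sub u by (metis f_simps image_eqI)
      qed
    next
      case xS: (Sub d l)
      with x have d: "d \<in> edges F" "l < j" by (auto simp: subdivide_def)
      show ?thesis
      proof (cases y)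
        case (Branch v)
        then have "v \<in> verts F" using y by (auto simp: subdivide_def)
        then show ?thesis using sub_not_branch[OF d] eq xS Branch by (metis f_simps image_eqI)
      next
        case (Sub e i)
        then have e: "e \<in> edges F" "i < j" using y by (auto simp: subdivide_def)
        have eq': "P d ! Suc l = P e ! Suc i" using eq xS Sub by simp
        have "P d ! Suc l \<in> set (P d)" "P e ! Suc i \<in> set (P e)"
          using len[OF d(1)] len[OF e(1)] d(2) e(2) by simp_all
        \<comment> \<open>Two different paths share only branch images by \<open>disj\<close>, and
          inner vertices are not branch images.\<close>
        then have "d = e"
          using disj[OF d(1) e(1)] sub_not_branch[OF d] eq' by metis
        then show ?thesis
          using nth_eq_iff_index_eq[OF dist[OF e(1)]] len[OF e(1)] eq' d(2) e(2) xS Sub by auto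
      qed
    qed
  qed
  have f_verts: "f ` verts ?S = \<phi> ` verts F \<union> (\<Union>e\<in>edges F. set (P e))"
  proof
    show "f ` verts ?S \<subseteq> \<phi> ` verts F \<union> (\<Union>e\<in>edges F. set (P e))"
    proof
      fix y assume "y \<in> f ` verts ?S"
      then consider v where "v \<in> verts F" "y = \<phi> v"
        | e i where "e \<in> edges F" "i < j" "y = P e ! Suc i"
        by (auto simp: subdivide_def)
      then show "y \<in> \<phi> ` verts F \<union> (\<Union>e\<in>edges F. set (P e))"
        by cases (use len in fastforce)+
    qed
    have "set (P e) \<subseteq> f ` verts ?S" if "e \<in> edges F" for e
      using image_mono[OF set_subdiv_path_subset[OF F that], of f "\<lambda>_. j"]
      by (metis list.set_map map_f[OF that])
    moreover have "\<phi> ` verts F \<subseteq> f ` verts ?S"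
      by (force simp: subdivide_def)
    ultimately show "\<phi> ` verts F \<union> (\<Union>e\<in>edges F. set (P e)) \<subseteq> f ` verts ?S"
      by blast
  qed
  have f_edges: "(\<lambda>e. f ` e) ` edges ?S = (\<Union>e\<in>edges F. path_edges (P e))"
    using map_f by (simp add: subdivide_def image_UN path_edges_map[symmetric])
  let ?H = "(f ` verts ?S, (\<lambda>e. f ` e) ` edges ?S)"
  have "graph_iso ?S ?H"
    unfolding graph_iso_def using inj_f by (auto simp: bij_betw_def)
  moreover have "induced_subgraph ?H G"
    unfolding induced_subgraph_def fst_conv snd_conv f_edges f_verts
  proof (intro conjI set_eqI iffI)
    show "\<phi> ` verts F \<union> (\<Union>e\<in>edges F. set (P e)) \<subseteq> verts G"
      using \<phi> set by blast
  next
    fix h assume "h \<in> (\<Union>e\<in>edges F. path_edges (P e))"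
    then obtain e where e: "e \<in> edges F" "h \<in> path_edges (P e)" by blast
    then have "h \<in> edges G" "h \<subseteq> set (P e)"
      using path[OF e(1)] path_edges_subset_set[OF e(2)] by auto
    then show "h \<in> {e \<in> edges G. e \<subseteq> \<phi> ` verts F \<union> (\<Union>e\<in>edges F. set (P e))}"
      using e(1) by blast
  next
    fix h assume "h \<in> {e \<in> edges G. e \<subseteq> \<phi> ` verts F \<union> (\<Union>e\<in>edges F. set (P e))}"
    then show "h \<in> (\<Union>e\<in>edges F. path_edges (P e))"
      using induced by blast
  qed
  ultimately have "appears_induced_in (k_subdivision j F) G"
    unfolding appears_induced_in_def k_subdivision_def by blast
  with F show ?thesis
    unfolding exact_top_degrees_def by blast
qed

section \<open>Sparsity of induced subgraphs and an orientation of small outdegree\<close>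

text \<open>A \<open>0\<close>-subdivision of a graph is a copy of the graph itself, so the set for
  \<open>0\<close> contains the average degree of every nonempty induced subgraph.\<close>

lemma edges_le_exact_0:
  assumes G: "simple_graph G" and bd: "\<And>x. x \<in> exact_top_degrees 0 G \<Longrightarrow> x \<le> real d"
    and U: "U \<subseteq> verts G"
  shows "2 * card {e \<in> edges G. e \<subseteq> U} \<le> d * card U"
\<comment> \<open>A simple graph has a vertex, so the empty set has to be treated apart.\<close>
proof (cases "U = {}")
  case True
  have "{e \<in> edges G. e \<subseteq> U} = {}"
    using G True by (auto simp: simple_graph_def)
  then show ?thesis by (simp only: card.empty)
next
  case False
  have finU: "finite U" using U G finite_subset by (auto simp: simple_graph_def)
  obtain \<phi> where \<phi>: "bij_betw \<phi> {0..<card U} U"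
    using ex_bij_betw_nat_finite[OF finU] by blast
  let ?V = "{0..<card U}"
  \<comment> \<open>\<open>F\<close> is the copy on natural numbers of the subgraph induced by
    \<open>U\<close>, since \<open>exact_top_degrees\<close> ranges over graphs of type
    \<open>nat ugraph\<close>.\<close>
  define F :: "nat ugraph" where "F = (?V, {e. e \<subseteq> ?V \<and> \<phi> ` e \<in> edges G})"
  have inj: "inj_on \<phi> ?V" and im: "\<phi> ` ?V = U" using \<phi> by (auto simp: bij_betw_def)
  have card_im: "card (\<phi> ` e) = card e" if "e \<subseteq> ?V" for e
    using card_image inj_on_subset[OF inj that] by blast
  have F: "simple_graph F"
    using False finU G by (auto simp: F_def simple_graph_def card_im[symmetric])
  have edge: "{\<phi> (Min e), \<phi> (Max e)} = \<phi> ` e" "\<phi> (Min e) \<noteq> \<phi> (Max e)"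
    "Min e \<in> ?V" "Max e \<in> ?V" "e = {Min e, Max e}"
    if e: "e \<in> edges F" for e
  proof -
    have 1: "card e = 2" "e \<subseteq> ?V" using e F by (auto simp: F_def simple_graph_def)
    note 2 = Min_Max_card_2[OF 1(1)]
    show "e = {Min e, Max e}" by (fact 2(1))
    then show "{\<phi> (Min e), \<phi> (Max e)} = \<phi> ` e" by (metis image_empty image_insert)
    show 3: "Min e \<in> ?V" "Max e \<in> ?V" using 1(2) 2(1) by blast+
    then show "\<phi> (Min e) \<noteq> \<phi> (Max e)" using inj 2(2) by (meson inj_onD)
  qed
  have "avg_degree F \<in> exact_top_degrees 0 G"
  \<comment> \<open>With \<open>j = 0\<close> each path consists of its two ends alone.\<close>
  proof (rule exact_top_degreesI[where \<phi> = \<phi> and P = "\<lambda>e. [\<phi> (Min e), \<phi> (Max e)]"])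
    show "simple_graph F" by fact
    show "inj_on \<phi> (verts F)" using inj by (simp add: F_def)
    show "\<phi> ` verts F \<subseteq> verts G" using im U by (simp add: F_def)
    fix e assume e: "e \<in> edges F"
    note E = edge[OF e]
    show "distinct [\<phi> (Min e), \<phi> (Max e)]" using E(2) by simp
    show "set [\<phi> (Min e), \<phi> (Max e)] \<subseteq> verts G" using E(3,4) im U by auto
    show "path_edges [\<phi> (Min e), \<phi> (Max e)] \<subseteq> edges G"
      using e E(1) by (auto simp: path_edges_def F_def)
    fix v assume "v \<in> verts F" "\<phi> v \<in> set [\<phi> (Min e), \<phi> (Max e)]"
    then have "v = Min e \<or> v = Max e"
      using inj_onD[OF inj _ _ E(3), of v] inj_onD[OF inj _ _ E(4), of v] by (auto simp: F_def)
    then show "v \<in> e" using E(5) by blast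
  next
    fix e e' x assume "e \<in> edges F" "x \<in> set [\<phi> (Min e), \<phi> (Max e)]"
    then show "x \<in> \<phi> ` verts F" using edge[of e] by (auto simp: F_def)
  next
    fix h assume h: "h \<in> edges G"
      "h \<subseteq> \<phi> ` verts F \<union> (\<Union>e\<in>edges F. set [\<phi> (Min e), \<phi> (Max e)])"
    have "h \<subseteq> \<phi> ` ?V" using h(2) edge(3,4) by (auto simp: F_def)
    then obtain e where e: "e \<subseteq> ?V" "h = \<phi> ` e" by (meson subset_imageE)
    then have eF: "e \<in> edges F" using h(1) by (simp add: F_def)
    have "h \<in> path_edges [\<phi> (Min e), \<phi> (Max e)]"
      using edge(1)[OF eF] e(2) by (auto simp: path_edges_def)
    with eF show "\<exists>e\<in>edges F. h \<in> path_edges [\<phi> (Min e), \<phi> (Max e)]" by blast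
  qed simp_all
  from bd[OF this] have "2 * real (card (edges F)) / real (card U) \<le> real d"
    by (simp add: avg_degree_def F_def)
  moreover have "card U > 0" using False finU by (simp add: card_gt_0_iff)
  ultimately have "2 * real (card (edges F)) \<le> real d * real (card U)"
    by (simp add: pos_divide_le_eq)
  then have *: "2 * card (edges F) \<le> d * card U"
    by (metis of_nat_le_iff of_nat_mult of_nat_numeral)
  have "{e \<in> edges G. e \<subseteq> U} \<subseteq> (\<lambda>e. \<phi> ` e) ` edges F"
  proof
    fix h assume h: "h \<in> {e \<in> edges G. e \<subseteq> U}"
    then have "h \<subseteq> \<phi> ` ?V" using im by blast
    then obtain e where "e \<subseteq> ?V" "h = \<phi> ` e" by (meson subset_imageE)
    with h show "h \<in> (\<lambda>e. \<phi> ` e) ` edges F" by (auto simp: F_def)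
  qed
  then have "card {e \<in> edges G. e \<subseteq> U} \<le> card (edges F)"
    using finite_edges[OF F] by (rule surj_card_le[rotated])
  with * show ?thesis by linarith
qed

text \<open>Degeneracy argument: every nonempty \<open>U\<close> has a vertex with at most
  \<open>d\<close> neighbours in \<open>U\<close>. Remove it, direct its edges within
  \<open>U\<close> away from it, and continue with the rest. Membership \<open>u \<in> out v\<close>
  means that the edge is directed from \<open>v\<close> to \<open>u\<close>.\<close>

lemma bounded_outdegree_orientation:
  assumes G: "simple_graph G"
    and sparse: "\<And>U. U \<subseteq> verts G \<Longrightarrow> 2 * card {e \<in> edges G. e \<subseteq> U} \<le> d * card U"
  obtains out where "\<And>v. finite (out v)" "\<And>v. card (out v) \<le> d"
    "\<And>v. out v \<subseteq> verts G"
    "\<And>u v. {u, v} \<in> edges G \<Longrightarrow> u \<in> out v \<or> v \<in> out u"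
proof -
  have "\<exists>out. (\<forall>v. out v \<subseteq> verts G \<and> card (out v) \<le> d) \<and>
      (\<forall>u v. {u, v} \<in> edges G \<longrightarrow> {u, v} \<subseteq> U \<longrightarrow> u \<in> out v \<or> v \<in> out u)"
    if "finite U" "U \<subseteq> verts G" for U
    using that
  proof (induction "card U" arbitrary: U)
    case 0
    then show ?case by (intro exI[of _ "\<lambda>_. {}"]) auto
  next
    case (Suc n)
    let ?E = "{e \<in> edges G. e \<subseteq> U}"
    have finE: "finite ?E" using finite_edges[OF G] by simp
    \<comment> \<open>Handshake count within \<open>U\<close>; comparing it with
      \<open>sparse\<close> shows that not all degrees exceed \<open>d\<close>.\<close>
    have "(\<Sum>v\<in>U. card {e \<in> ?E. v \<in> e}) = 2 * card ?E"
    proof (rule sum_multicount)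
      show "\<forall>e\<in>?E. card {v \<in> U. v \<in> e} = 2"
      proof
        fix e assume "e \<in> ?E"
        then have "{v \<in> U. v \<in> e} = e" "card e = 2" using G by (auto simp: simple_graph_def)
        then show "card {v \<in> U. v \<in> e} = 2" by simp
      qed
    qed (use Suc.prems finE in auto)
    then have sum_le: "(\<Sum>v\<in>U. card {e \<in> ?E. v \<in> e}) \<le> (\<Sum>v\<in>U. d)"
      using sparse[OF Suc.prems(2)] by (simp add: mult.commute)
    have "\<exists>v\<in>U. card {e \<in> ?E. v \<in> e} \<le> d"
    proof (rule ccontr)
      assume "\<not> ?thesis"
      then have "(\<Sum>v\<in>U. d) < (\<Sum>v\<in>U. card {e \<in> ?E. v \<in> e})"
        using Suc.hyps(2) by (intro sum_strict_mono Suc.prems) (auto simp: not_le)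
      with sum_le show False by simp
    qed
    then obtain v where v: "v \<in> U" "card {e \<in> ?E. v \<in> e} \<le> d" by blast
    \<comment> \<open>The new value of \<open>out v\<close>. It covers all edges inside
      \<open>U\<close> at \<open>v\<close>, and the induction hypothesis for \<open>U - {v}\<close>
      covers the others.\<close>
    let ?N = "{u. {u, v} \<in> ?E}"
    have "card ?N \<le> card {e \<in> ?E. v \<in> e}"
      by (rule card_inj_on_le[where f = "\<lambda>u. {u, v}"])
        (use finite_edges[OF G] in \<open>auto simp: inj_on_def doubleton_eq_iff\<close>)
    with v(2) have N: "card ?N \<le> d" "?N \<subseteq> verts G" using Suc.prems(2) by auto
    have "n = card (U - {v})" "finite (U - {v})" "U - {v} \<subseteq> verts G"
      using Suc v(1) by auto
    from Suc.hyps(1)[OF this] obtain out where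
      out: "\<And>w. out w \<subseteq> verts G \<and> card (out w) \<le> d"
        "\<And>u w. {u, w} \<in> edges G \<Longrightarrow> {u, w} \<subseteq> U - {v} \<Longrightarrow> u \<in> out w \<or> w \<in> out u"
      by metis
    have "u \<in> (out(v := ?N)) w \<or> w \<in> (out(v := ?N)) u"
      if uw: "{u, w} \<in> edges G" "{u, w} \<subseteq> U" for u w
    proof (cases "u = v \<or> w = v")
      case True
      then show ?thesis using uw by (auto simp: insert_commute)
    next
      case False
      then show ?thesis using out(2)[of u w] uw by auto
    qed
    then show ?case using out(1) N by (intro exI[of _ "out(v := ?N)"]) auto
  qed
  moreover have fin: "finite (verts G)" using G by (simp add: simple_graph_def)
  moreover have "{u, v} \<subseteq> verts G" if "{u, v} \<in> edges G" for u v
    using that G by (auto simp: simple_graph_def)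
  ultimately obtain out where "\<And>v. out v \<subseteq> verts G" "\<And>v. card (out v) \<le> d"
    "\<And>u v. {u, v} \<in> edges G \<Longrightarrow> u \<in> out v \<or> v \<in> out u"
    by (metis order_refl)
  then show thesis using that fin finite_subset by metis
qed

section \<open>The random vertex set, by averaging\<close>

text \<open>For a uniformly random \<open>R \<subseteq> W\<close>, each \<open>i\<close> is good
  with probability at least \<open>2\<close> to the power \<open>- t\<close>, because membership in
  \<open>R\<close> is prescribed for at most \<open>t\<close> elements. Some \<open>R\<close> does
  at least as well as the expectation; the proof counts subsets in place of probabilities.\<close>

lemma exists_separating_subset:
  assumes W: "finite W" and I: "finite I"
    and sub: "\<And>i. i \<in> I \<Longrightarrow> A i \<subseteq> W \<and> X i \<subseteq> W \<and> A i \<inter> X i = {}"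
    and t: "\<And>i. i \<in> I \<Longrightarrow> card (A i \<union> X i) \<le> t"
  obtains R where "R \<subseteq> W" "card I \<le> 2 ^ t * card {i \<in> I. A i \<subseteq> R \<and> X i \<inter> R = {}}"
proof -
  let ?g = "\<lambda>R. {i \<in> I. A i \<subseteq> R \<and> X i \<inter> R = {}}"
  let ?T = "\<lambda>i. {R \<in> Pow W. A i \<subseteq> R \<and> X i \<inter> R = {}}"
  have one: "2 ^ card W \<le> 2 ^ t * card (?T i)" if i: "i \<in> I" for i
  proof -
    let ?Y = "A i \<union> X i"
    have Y: "?Y \<subseteq> W" using sub[OF i] by auto
    \<comment> \<open>Outside \<open>A i \<union> X i\<close> the choice of \<open>R\<close> is
      free; adding \<open>A i\<close> to such a choice gives a member of
      \<open>?T i\<close>.\<close>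
    have "card (Pow (W - ?Y)) \<le> card (?T i)"
      by (rule card_inj_on_le[where f = "\<lambda>R. R \<union> A i"])
        (use W sub[OF i] in \<open>auto simp: inj_on_def\<close>)
    then have "2 ^ (card W - card ?Y) \<le> card (?T i)"
      using W Y by (simp add: card_Pow card_Diff_subset[OF finite_subset[OF Y W] Y])
    moreover have "card W \<le> t + (card W - card ?Y)"
      using t[OF i] by linarith
    then have "(2::nat) ^ card W \<le> 2 ^ t * 2 ^ (card W - card ?Y)"
      unfolding power_add[symmetric] by (intro power_increasing) auto
    ultimately show ?thesis by (meson le_trans mult_le_mono2)
  qed
  \<comment> \<open>Double count of the pairs of a set \<open>R\<close> and an index
    \<open>i\<close> that is good for \<open>R\<close>.\<close>
  have swap: "(\<Sum>R\<in>Pow W. card (?g R)) = (\<Sum>i\<in>I. card (?T i))"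
    using sum.swap_restrict[of "Pow W" I "\<lambda>_ _. 1::nat" "\<lambda>R i. A i \<subseteq> R \<and> X i \<inter> R = {}"] W I
    by simp
  have "(\<Sum>R\<in>Pow W. card I) = (\<Sum>i\<in>I. 2 ^ card W)"
    using W by (simp add: card_Pow mult.commute)
  also have "\<dots> \<le> (\<Sum>i\<in>I. 2 ^ t * card (?T i))"
    by (intro sum_mono one)
  also have "\<dots> = (\<Sum>R\<in>Pow W. 2 ^ t * card (?g R))"
    using swap by (simp add: sum_distrib_left[symmetric])
  finally have le: "(\<Sum>R\<in>Pow W. card I) \<le> (\<Sum>R\<in>Pow W. 2 ^ t * card (?g R))" .
  have "\<exists>R\<in>Pow W. card I \<le> 2 ^ t * card (?g R)"
  proof (rule ccontr)
    assume "\<not> ?thesis"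
    then have "(\<Sum>R\<in>Pow W. 2 ^ t * card (?g R)) < (\<Sum>R\<in>Pow W. card I)"
      using W by (intro sum_strict_mono) (auto simp: not_le)
    with le show False by simp
  qed
  then show thesis using that by blast
qed

section \<open>Shortening a walk to an induced path\<close>

text \<open>The form with \<open>successively\<close> splits along appends, which suits cutting and
  splicing walks.\<close>

lemma path_edges_subset_iff_successively:
  "path_edges p \<subseteq> E \<longleftrightarrow> successively (\<lambda>u v. {u, v} \<in> E) p"
  by (auto simp: path_edges_def successively_conv_nth)

text \<open>Take a shortest walk with the same ends inside \<open>set p\<close>: a repeated vertex
  or a chord would allow a shorter one.\<close>

lemma exists_induced_path:
  assumes p: "p \<noteq> []" "path_edges p \<subseteq> E" and E: "\<And>e. e \<in> E \<Longrightarrow> card e = 2"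
  obtains q where "q \<noteq> []" "hd q = hd p" "last q = last p" "set q \<subseteq> set p" "length q \<le> length p"
    "distinct q" "path_edges q \<subseteq> E" "\<And>e. e \<in> E \<Longrightarrow> e \<subseteq> set q \<Longrightarrow> e \<in> path_edges q"
proof -
  let ?adj = "\<lambda>u v. {u, v} \<in> E"
  let ?Q = "\<lambda>q. q \<noteq> [] \<and> hd q = hd p \<and> last q = last p \<and> set q \<subseteq> set p \<and> successively ?adj q"
  have "?Q p" using p by (simp add: path_edges_subset_iff_successively)
  then obtain q where Q: "?Q q" and min: "\<And>r. ?Q r \<Longrightarrow> length q \<le> length r"
    using ex_has_least_nat[of ?Q p length] by blast
  \<comment> \<open>An edge from position \<open>i - 1\<close> to position \<open>j\<close> lets the
    walk skip the positions from \<open>i\<close> to \<open>j - 1\<close>, of which there is at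
    least one.\<close>
  have shortcut: False
    if ij: "0 < i" "i < j" "j < length q" and adj: "{q ! (i - 1), q ! j} \<in> E" for i j
  proof -
    let ?r = "take i q @ drop j q"
    have ne: "take i q \<noteq> []" "drop j q \<noteq> []" using ij by auto
    have q: "successively ?adj q" using Q by simp
    have "successively ?adj (take i q)" "successively ?adj (drop j q)"
      using q by (metis append_take_drop_id successively_append_iff)+
    moreover have "last (take i q) = q ! (i - 1)" "hd (drop j q) = q ! j"
      using ij last_conv_nth[OF ne(1)] by (simp_all add: hd_drop_conv_nth min_def)
    ultimately have "successively ?adj ?r"
      using adj by (simp add: successively_append_iff)
    moreover have "hd ?r = hd p" "last ?r = last p"
      using ne ij Q by (auto simp: hd_append)
    moreover have "set ?r \<subseteq> set p"
      using Q set_take_subset[of i q] set_drop_subset[of j q] by auto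
    ultimately have "?Q ?r" using ne by simp
    from min[OF this] show False using ij by simp
  qed
  \<comment> \<open>If the start recurs at \<open>j\<close>, the walk may begin at \<open>j\<close>.
    Otherwise the edge into position \<open>i\<close> is also an edge from position
    \<open>i - 1\<close> to position \<open>j\<close>, so \<open>shortcut\<close> applies.\<close>
  have neq: "q ! i \<noteq> q ! j" if ij: "i < j" "j < length q" for i j
  proof
    assume eq: "q ! i = q ! j"
    show False
    proof (cases "i = 0")
      case True
      have "successively ?adj (take j q @ drop j q)" using Q by simp
      then have "successively ?adj (drop j q)" unfolding successively_append_iff by blast
      moreover have "hd (drop j q) = hd p"
        using Q ij eq True hd_conv_nth[of q] by (simp add: hd_drop_conv_nth)
      ultimately have "?Q (drop j q)"
        using Q ij set_drop_subset[of j q] by auto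
      from min[OF this] show False using ij by simp
    next
      case False
      have "{q ! (i - 1), q ! Suc (i - 1)} \<in> E"
      proof -
        have "Suc (i - 1) < length q" using ij False by linarith
        moreover have "successively ?adj q" using Q by blast
        ultimately show ?thesis unfolding successively_conv_nth by blast
      qed
      then show False using shortcut[of i j] ij False eq by simp
    qed
  qed
  show thesis
  proof (rule that[of q])
    show "q \<noteq> []" "hd q = hd p" "last q = last p" "set q \<subseteq> set p" using Q by auto
    show "length q \<le> length p" using min \<open>?Q p\<close> by blast
    show "distinct q" unfolding distinct_conv_nth
      using neq by (metis linorder_neqE_nat)
    show "path_edges q \<subseteq> E" using Q by (simp add: path_edges_subset_iff_successively)
    fix e assume e: "e \<in> E" "e \<subseteq> set q"
    then obtain x y where xy: "e = {x, y}" "x \<noteq> y" using E by (metis card_2_iff)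
    then obtain a b where "x = q ! a" "y = q ! b" "a < length q" "b < length q"
      using e(2) by (auto simp: in_set_conv_nth)
    then obtain i j where ij: "e = {q ! i, q ! j}" "i < j" "j < length q"
      using xy by (cases a b rule: linorder_cases) (auto simp: insert_commute)
    \<comment> \<open>A chord between positions \<open>i\<close> and \<open>j\<close> is a shortcut
      that skips from \<open>Suc i\<close> on.\<close>
    have "\<not> Suc i < j"
      using shortcut[of "Suc i" j] ij e(1) by auto
    then have "j = Suc i" using ij(2) by linarith
    then show "e \<in> path_edges q" using ij by (auto simp: path_edges_def)
  qed
qed

section \<open>Density of \<open>F\<close> from the densities of exact induced subdivisions\<close>

lemma avg_degree_le_of_exact:
  fixes F :: "nat ugraph"
  assumes G: "simple_graph G" and F: "simple_graph F"
    and bd: "\<And>j x. x \<in> exact_top_degrees j G \<Longrightarrow> x \<le> real (f j)"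
    and s: "\<And>e. e \<in> edges F \<Longrightarrow> s e \<le> k"
    and app: "appears_in (subdivide F s) G"
  shows "avg_degree F \<le> real (2 ^ ((k + 2) * (f 0 + 1)) * (\<Sum>j\<le>k. f j))"
proof -
  let ?S = "subdivide F s"
  obtain H' g where H': "subgraph H' G" and g: "bij_betw g (verts ?S) (verts H')"
    and edges_H': "edges H' = (\<lambda>e. g ` e) ` edges ?S"
    using app unfolding appears_in_def graph_iso_def by blast
  have inj: "inj_on g (verts ?S)" and gV: "g ` verts ?S \<subseteq> verts G"
    and gE: "(\<lambda>e. g ` e) ` edges ?S \<subseteq> edges G"
    using g H' edges_H' by (auto simp: bij_betw_def subgraph_def)
  have cardF: "card e = 2" "e \<subseteq> verts F" if "e \<in> edges F" for e
    using F that by (auto simp: simple_graph_def)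
  have path: "set (subdiv_path s e) \<subseteq> verts ?S" if "e \<in> edges F" for e
    by (rule set_subdiv_path_subset[OF F that])
  \<comment> \<open>Passing to an induced path may shorten it, so only the bound
    \<open>k + 2\<close> on its length is kept, not the value \<open>s e + 2\<close>.\<close>
  have "\<exists>q. q \<noteq> [] \<and> hd q = g (Branch (Min e)) \<and> last q = g (Branch (Max e)) \<and>
      set q \<subseteq> g ` set (subdiv_path s e) \<and> length q \<le> k + 2 \<and> distinct q \<and>
      path_edges q \<subseteq> edges G \<and> (\<forall>h\<in>edges G. h \<subseteq> set q \<longrightarrow> h \<in> path_edges q)"
    if e: "e \<in> edges F" for e
  proof -
    let ?p = "map g (subdiv_path s e)"
    have pe: "path_edges ?p \<subseteq> edges G"
      using gE e by (auto simp: path_edges_map subdivide_def)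
    have ne: "?p \<noteq> []" and ends: "hd ?p = g (Branch (Min e))" "last ?p = g (Branch (Max e))"
      by (auto simp: subdiv_path_def)
    have "card h = 2" if "h \<in> edges G" for h
      using G that by (auto simp: simple_graph_def)
    from exists_induced_path[OF ne pe this] obtain q where
      "q \<noteq> []" "hd q = hd ?p" "last q = last ?p" "set q \<subseteq> set ?p" "length q \<le> length ?p"
      "distinct q" "path_edges q \<subseteq> edges G" "\<And>h. h \<in> edges G \<Longrightarrow> h \<subseteq> set q \<Longrightarrow> h \<in> path_edges q"
      by blast
    then show ?thesis using ends s[OF e] by (intro exI[of _ q]) auto
  qed
  then obtain P where P: "\<And>e. e \<in> edges F \<Longrightarrow> P e \<noteq> [] \<and> hd (P e) = g (Branch (Min e)) \<and>
      last (P e) = g (Branch (Max e)) \<and> set (P e) \<subseteq> g ` set (subdiv_path s e) \<and>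
      length (P e) \<le> k + 2 \<and> distinct (P e) \<and> path_edges (P e) \<subseteq> edges G \<and>
      (\<forall>h\<in>edges G. h \<subseteq> set (P e) \<longrightarrow> h \<in> path_edges (P e))"
    by metis
  let ?\<phi> = "\<lambda>v. g (Branch v)"
  have inj\<phi>: "inj_on ?\<phi> (verts F)"
  proof (rule inj_onI)
    fix u v assume "u \<in> verts F" "v \<in> verts F" "?\<phi> u = ?\<phi> v"
    then show "u = v" using inj_onD[OF inj, of "Branch u" "Branch v"] by (auto simp: subdivide_def)
  qed
  have PV: "set (P e) \<subseteq> verts G" if "e \<in> edges F" for e
    using P[OF that] path[OF that] gV by blast
  have ends_in: "?\<phi> v \<in> set (P e)" if "e \<in> edges F" "v \<in> e" for e v
  proof -
    have "v = Min e \<or> v = Max e" using Min_Max_card_2(1)[OF cardF(1)] that by blast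
    then show ?thesis using P[OF that(1)] by (metis hd_in_set last_in_set)
  qed
  have branch: "v \<in> e" if e: "e \<in> edges F" and v: "v \<in> verts F" "?\<phi> v \<in> set (P e)" for e v
  proof -
    have "?\<phi> v \<in> g ` set (subdiv_path s e)" using P[OF e] v(2) by (meson subsetD)
    then obtain a where a: "a \<in> set (subdiv_path s e)" "?\<phi> v = g a" by blast
    moreover have "Branch v \<in> verts ?S" using v by (simp add: subdivide_def)
    ultimately have "Branch v = a" using inj path[OF e] by (meson inj_onD subsetD)
    then have "v = Min e \<or> v = Max e" using a by (auto simp: set_subdiv_path)
    then show ?thesis using Min_Max_card_2(1)[OF cardF(1)[OF e]] by blast
  qed
  \<comment> \<open>Locating the shared vertex over a common end of both edges, and not merely over
    \<open>verts F\<close>, allows use for subgraphs of \<open>F\<close> with fewer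
    vertices.\<close>
  have disj: "x \<in> ?\<phi> ` (e \<inter> e')"
    if e: "e \<in> edges F" "e' \<in> edges F" "e \<noteq> e'" and x: "x \<in> set (P e)" "x \<in> set (P e')"
    for e e' x
  proof -
    have "x \<in> g ` set (subdiv_path s e)" "x \<in> g ` set (subdiv_path s e')"
      using P[OF e(1)] P[OF e(2)] x by (meson subsetD)+
    then obtain a b where ab: "a \<in> set (subdiv_path s e)" "x = g a"
      "b \<in> set (subdiv_path s e')" "x = g b"
      by blast
    then have "a = b" using inj_onD[OF inj, of a b] path[OF e(1)] path[OF e(2)] by auto
    then obtain v where v: "a = Branch v" using ab e(3) by (auto simp: set_subdiv_path)
    have "Branch v \<in> verts ?S" using ab(1) path[OF e(1)] v by blast
    then have "v \<in> verts F" by (auto simp: subdivide_def)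
    then have "v \<in> e" "v \<in> e'" using branch[of _ v] e x ab(2) v by auto
    then show ?thesis using ab(2) v by blast
  qed
  obtain out where out: "\<And>v. finite (out v)" "\<And>v. card (out v) \<le> f 0" "\<And>v. out v \<subseteq> verts G"
    "\<And>u v. {u, v} \<in> edges G \<Longrightarrow> u \<in> out v \<or> v \<in> out u"
    using bounded_outdegree_orientation[OF G edges_le_exact_0[OF G bd[of _ 0]]] by blast
  \<comment> \<open>The vertices that \<open>R\<close> has to avoid for \<open>e\<close> to
    survive.\<close>
  define X where "X e = (\<Union>v\<in>set (P e). out v) - set (P e)" for e
  have finF: "finite (verts F)" "finite (edges F)" "verts F \<noteq> {}"
    using F finite_edges[OF F] by (simp_all add: simple_graph_def)
  \<comment> \<open>At most \<open>k + 2\<close> path vertices, each contributing itself and at most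
    \<open>f 0\<close> out-neighbours.\<close>
  have card_AX: "card (set (P e) \<union> X e) \<le> (k + 2) * (f 0 + 1)" if e: "e \<in> edges F" for e
  proof -
    have 1: "card (set (P e)) \<le> k + 2"
      using P[OF e] card_length[of "P e"] by linarith
    have "card (X e) \<le> card (\<Union>v\<in>set (P e). out v)"
      unfolding X_def using out(1) by (intro card_mono) auto
    also have "\<dots> \<le> (\<Sum>v\<in>set (P e). card (out v))" by (rule card_UN_le) simp
    also have "\<dots> \<le> card (set (P e)) * f 0"
      using sum_bounded_above[of "set (P e)" "\<lambda>v. card (out v)" "f 0"] out(2) by simp
    also have "\<dots> \<le> (k + 2) * f 0" using 1 by (rule mult_le_mono1)
    finally show ?thesis using 1 card_Un_le[of "set (P e)" "X e"] by (simp add: algebra_simps)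
  qed
  have "finite (verts G)" using G by (simp add: simple_graph_def)
  moreover have "set (P e) \<subseteq> verts G \<and> X e \<subseteq> verts G \<and> set (P e) \<inter> X e = {}"
    if "e \<in> edges F" for e
    using PV[OF that] out(3) by (auto simp: X_def)
  ultimately obtain R where R: "card (edges F) \<le> 2 ^ ((k + 2) * (f 0 + 1)) *
      card {e \<in> edges F. set (P e) \<subseteq> R \<and> X e \<inter> R = {}}"
    using exists_separating_subset[of "verts G" "edges F" "\<lambda>e. set (P e)" X "(k + 2) * (f 0 + 1)"]
      finF(2) card_AX by metis
  define M where "M = {e \<in> edges F. set (P e) \<subseteq> R \<and> X e \<inter> R = {}}"
  have MF: "M \<subseteq> edges F" by (auto simp: M_def)
  have finM: "finite M" using MF finF finite_subset by blast
  \<comment> \<open>Surviving edges sorted by the number \<open>j\<close> of inner vertices; the two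
    ends account for \<open>+ 2\<close>.\<close>
  define L where "L j = {e \<in> M. length (P e) = j + 2}" for j
  have L_bd: "2 * card (L j) \<le> f j * card (verts F)" for j
  proof (cases "L j = {}")
    case False
    \<comment> \<open>Only ends of edges in \<open>L j\<close> are kept as vertices, so every branch
      vertex lies on a surviving path and the argument about directed edges applies to it
      too.\<close>
    let ?F = "(\<Union>(L j), L j)"
    have LF: "e \<in> edges F" if "e \<in> L j" for e using that MF by (auto simp: L_def)
    have UL: "\<Union>(L j) \<subseteq> verts F" using LF cardF(2) by blast
    have "finite (\<Union>(L j))" using UL finF finite_subset by blast
    moreover have "\<Union>(L j) \<noteq> {}" using False LF cardF(1) by fastforce
    ultimately have F': "simple_graph ?F" and pos: "card (\<Union>(L j)) > 0"
      using LF cardF(1) by (auto simp: simple_graph_def card_gt_0_iff)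
    have "avg_degree ?F \<in> exact_top_degrees j G"
    proof (rule exact_top_degreesI[OF F', where \<phi> = ?\<phi> and P = P], unfold fst_conv snd_conv)
      show "inj_on ?\<phi> (\<Union>(L j))" using inj\<phi> UL inj_on_subset by blast
      show "?\<phi> ` \<Union>(L j) \<subseteq> verts G" using LF PV ends_in by blast
    next
      fix e assume e: "e \<in> L j"
      show "length (P e) = j + 2" using e by (simp add: L_def)
      show "distinct (P e)" "hd (P e) = ?\<phi> (Min e)" "last (P e) = ?\<phi> (Max e)"
        "path_edges (P e) \<subseteq> edges G" "set (P e) \<subseteq> verts G"
        using P[OF LF[OF e]] PV[OF LF[OF e]] by auto
      show "v \<in> e" if "v \<in> \<Union>(L j)" "?\<phi> v \<in> set (P e)" for v
        using branch[OF LF[OF e]] that UL by blast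
    next
      fix e e' x assume "e \<in> L j" "e' \<in> L j" "e \<noteq> e'" "x \<in> set (P e)" "x \<in> set (P e')"
      then show "x \<in> ?\<phi> ` \<Union>(L j)" using disj[of e e' x] LF by blast
    next
      fix h assume h: "h \<in> edges G" "h \<subseteq> ?\<phi> ` \<Union>(L j) \<union> (\<Union>e\<in>L j. set (P e))"
      have sub: "h \<subseteq> (\<Union>e\<in>L j. set (P e))" using h(2) ends_in LF by blast
      have *: "\<exists>e\<in>L j. {x, y} \<subseteq> set (P e)"
        if y: "y \<in> out x"
          and xy: "x \<in> (\<Union>e\<in>L j. set (P e))" "y \<in> (\<Union>e\<in>L j. set (P e))" for x y
      proof -
        obtain e e' where e: "e \<in> L j" "x \<in> set (P e)" "e' \<in> L j" "y \<in> set (P e')"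
          using xy by blast
        then have "y \<in> R" "X e \<inter> R = {}" by (auto simp: L_def M_def)
        then have "y \<in> set (P e)" using y e(2) by (auto simp: X_def)
        then show ?thesis using e by blast
      qed
      obtain x y where xy: "h = {x, y}" using simple_graph_edge[OF G h(1)] by metis
      \<comment> \<open>Whichever way \<open>h\<close> is directed, \<open>*\<close> places both of
        its ends on one path; as that path is induced, \<open>h\<close> is one of its edges.\<close>
      then have "\<exists>e\<in>L j. h \<subseteq> set (P e)"
        using out(4)[of x y] h(1) sub *[of x y] *[of y x] by (auto simp: insert_commute)
      then show "\<exists>e\<in>L j. h \<in> path_edges (P e)" using P LF h(1) by blast
    qed
    from bd[OF this] have "2 * real (card (L j)) / real (card (\<Union>(L j))) \<le> real (f j)"
      by (simp add: avg_degree_def)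
    then have "2 * real (card (L j)) \<le> real (f j) * real (card (\<Union>(L j)))"
      using pos by (simp add: pos_divide_le_eq)
    then have "2 * card (L j) \<le> f j * card (\<Union>(L j))"
      by (metis of_nat_le_iff of_nat_mult of_nat_numeral)
    also have "\<dots> \<le> f j * card (verts F)"
      using UL finF by (intro mult_le_mono2 card_mono)
    finally show ?thesis .
  qed simp
  \<comment> \<open>The ends of \<open>P e\<close> are distinct, so its length is at least
    \<open>2\<close> and has the form \<open>j + 2\<close>; the bound \<open>k + 2\<close> then
    gives \<open>j \<le> k\<close>.\<close>
  have "M \<subseteq> (\<Union>j\<le>k. L j)"
  proof
    fix e assume e: "e \<in> M"
    then have eF: "e \<in> edges F" using MF by blast
    have "?\<phi> (Min e) \<noteq> ?\<phi> (Max e)"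
      using Min_Max_card_2[OF cardF(1)[OF eF]] cardF(2)[OF eF] inj\<phi> by (metis inj_on_def insert_subset)
    with P[OF eF] have "2 \<le> length (P e)"
      by (cases "P e") (auto simp: Suc_le_eq split: if_splits)
    then obtain j where "length (P e) = j + 2" by (metis add.commute le_Suc_ex)
    moreover from this have "j \<le> k" using P[OF eF] by simp
    ultimately show "e \<in> (\<Union>j\<le>k. L j)" using e by (auto simp: L_def)
  qed
  then have "card M \<le> card (\<Union>j\<le>k. L j)"
    by (rule card_mono[rotated]) (use finM in \<open>auto simp: L_def\<close>)
  also have "\<dots> \<le> (\<Sum>j\<le>k. card (L j))" by (rule card_UN_le) simp
  finally have "2 * card M \<le> (\<Sum>j\<le>k. 2 * card (L j))" by (simp add: sum_distrib_left[symmetric])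
  also have "\<dots> \<le> (\<Sum>j\<le>k. f j * card (verts F))" by (intro sum_mono L_bd)
  finally have M_bd: "2 * card M \<le> (\<Sum>j\<le>k. f j) * card (verts F)"
    by (simp add: sum_distrib_right)
  \<comment> \<open>The power of \<open>2\<close> is the loss from restricting to surviving edges,
    and the sum of the \<open>f j\<close> bounds the density of these.\<close>
  have "2 * card (edges F) \<le> 2 ^ ((k + 2) * (f 0 + 1)) * (2 * card M)"
    using R by (simp add: M_def)
  also have "\<dots> \<le> 2 ^ ((k + 2) * (f 0 + 1)) * ((\<Sum>j\<le>k. f j) * card (verts F))"
    using M_bd by (rule mult_le_mono2)
  finally have "2 * card (edges F) \<le> 2 ^ ((k + 2) * (f 0 + 1)) * (\<Sum>j\<le>k. f j) * card (verts F)"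
    by (simp only: mult.assoc)
  then have "real (2 * card (edges F)) \<le>
      real (2 ^ ((k + 2) * (f 0 + 1)) * (\<Sum>j\<le>k. f j) * card (verts F))"
    by (rule of_nat_mono)
  moreover have "card (verts F) > 0" using finF by (simp add: card_gt_0_iff)
  ultimately show ?thesis
    unfolding avg_degree_def by (simp only: of_nat_mult pos_divide_le_eq of_nat_0_less_iff of_nat_numeral)
qed

section \<open>Comparison of the three maxima and the equivalence\<close>

lemma top_degrees_nonempty:
  assumes "simple_graph G"
  shows "ind_top_degrees k G \<noteq> {}" "top_degrees k G \<noteq> {}"
  using exact_top_degrees_nonempty[OF assms] exact_subset_ind ind_subset_top by blast+

text \<open>The three sets of degrees are nested; that they are finite and nonempty makes
  \<open>Max\<close> monotone along the inclusions.\<close>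

lemma nabla_mono:
  assumes "simple_graph G"
  shows "nabla_exact k G \<le> nabla_ind k G" "nabla_ind k G \<le> nabla k G"
proof -
  have fin: "finite (top_degrees k G)" by (rule finite_top_degrees[OF assms])
  show "nabla_ind k G \<le> nabla k G" unfolding nabla_ind_def nabla_def
    by (rule Max_mono[OF ind_subset_top top_degrees_nonempty(1)[OF assms] fin])
  show "nabla_exact k G \<le> nabla_ind k G" unfolding nabla_ind_def nabla_exact_def
    by (rule Max_mono[OF exact_subset_ind exact_top_degrees_nonempty[OF assms]
          finite_subset[OF ind_subset_top fin]])
qed

lemma nabla_le_of_exact:
  assumes G: "simple_graph G" and bd: "\<And>j. nabla_exact j G \<le> real (f j)"
  shows "nabla k G \<le> real (2 ^ ((k + 2) * (f 0 + 1)) * (\<Sum>j\<le>k. f j))"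
proof -
  have fin: "finite (top_degrees j G)" for j by (rule finite_top_degrees[OF G])
  have ex: "x \<le> real (f j)" if "x \<in> exact_top_degrees j G" for j x
  proof -
    have "finite (exact_top_degrees j G)"
      using fin exact_subset_ind ind_subset_top by (metis finite_subset)
    then have "x \<le> nabla_exact j G" unfolding nabla_exact_def using that by (rule Max_ge)
    then show ?thesis using bd by (rule order_trans)
  qed
  show ?thesis unfolding nabla_def
  proof (rule Max.boundedI[OF fin top_degrees_nonempty(2)[OF G]])
    fix x assume "x \<in> top_degrees k G"
    then obtain F :: "nat ugraph" and s where "x = avg_degree F" "simple_graph F"
      "\<forall>e\<in>edges F. s e \<le> k" "appears_in (subdivide F s) G"
      unfolding top_degrees_def le_subdivisions_def by blast
    then show "x \<le> real (2 ^ ((k + 2) * (f 0 + 1)) * (\<Sum>j\<le>k. f j))"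
      using avg_degree_le_of_exact[where f = f, OF G _ ex] by blast
  qed
qed

theorem theorem4:
  fixes \<G> :: "'a ugraph set"
  assumes "\<forall>G\<in>\<G>. simple_graph G"
  shows "(bounded_expansion \<G> \<longleftrightarrow>
            (\<exists>f :: nat \<Rightarrow> nat. \<forall>G\<in>\<G>. \<forall>k. nabla_ind k G \<le> real (f k))) \<and>
         ((\<exists>f :: nat \<Rightarrow> nat. \<forall>G\<in>\<G>. \<forall>k. nabla_ind k G \<le> real (f k)) \<longleftrightarrow>
            (\<exists>f :: nat \<Rightarrow> nat. \<forall>G\<in>\<G>. \<forall>k. nabla_exact k G \<le> real (f k)))"
    (is "(_ \<longleftrightarrow> ?b) \<and> (_ \<longleftrightarrow> ?c)")
proof -
  have le: "nabla_exact k G \<le> nabla_ind k G" "nabla_ind k G \<le> nabla k G" if "G \<in> \<G>" for G k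
    using nabla_mono[of G k] assms that by simp_all
  have ab: ?b if "bounded_expansion \<G>"
  proof -
    from that obtain f :: "nat \<Rightarrow> nat" where "\<forall>G\<in>\<G>. \<forall>k. nabla k G \<le> real (f k)"
      unfolding bounded_expansion_def by (rule exE)
    then have "\<forall>G\<in>\<G>. \<forall>k. nabla_ind k G \<le> real (f k)"
      using le(2) order_trans by fast
    then show ?b by (rule exI[of _ f])
  qed
  have bc: ?c if b: ?b
  proof -
    from b obtain f :: "nat \<Rightarrow> nat" where "\<forall>G\<in>\<G>. \<forall>k. nabla_ind k G \<le> real (f k)"
      by (rule exE)
    then have "\<forall>G\<in>\<G>. \<forall>k. nabla_exact k G \<le> real (f k)"
      using le(1) order_trans by fast
    then show ?c by (rule exI[of _ f])
  qed
  have ca: "bounded_expansion \<G>" if c: ?c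
  proof -
    from c obtain f :: "nat \<Rightarrow> nat" where f: "\<forall>G\<in>\<G>. \<forall>k. nabla_exact k G \<le> real (f k)"
      by (rule exE)
    have "\<forall>G\<in>\<G>. \<forall>k. nabla k G \<le> real (2 ^ ((k + 2) * (f 0 + 1)) * (\<Sum>j\<le>k. f j))"
    proof (intro ballI allI)
      fix G k assume "G \<in> \<G>"
      with assms f show "nabla k G \<le> real (2 ^ ((k + 2) * (f 0 + 1)) * (\<Sum>j\<le>k. f j))"
        by (intro nabla_le_of_exact) simp_all
    qed
    then show ?thesis
      unfolding bounded_expansion_def
      by (rule exI[of _ "\<lambda>k. 2 ^ ((k + 2) * (f 0 + 1)) * (\<Sum>j\<le>k. f j)"])
  qed
  \<comment> \<open>The implications \<open>ab\<close>, \<open>bc\<close> and \<open>ca\<close> form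
    a cycle; each missing converse is a composition of two of them.\<close>
  show ?thesis
    by (rule conjI; rule iffI) (erule ab, erule ca[OF bc], erule bc, erule ab[OF ca])
qed

end
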